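(* Let $\mathcal E$ be a countable hypergraph such that any infinite set $I\subseteq\bigcup\mathcal E$ contains a finite subset $F\subseteq I$ for which the family $\mathcal E_F:=\{E\in\mathcal E:F\subseteq E\}$ is finite. Then $\mathcal E$ has a minimal cover.
   Context: A hypergraph is any family (i.e. set) $\mathcal E$ of sets; its elements are called edges and the elements of $\bigcup\mathcal E$ are called vertices. A hypergraph $\mathcal E$ is countable if both sets $\mathcal E$ and $\bigcup\mathcal E$ are countable. A subset $\mathcal C\subseteq\mathcal E$ is a cover of $\mathcal E$ if $\bigcup\mathcal C=\bigcup\mathcal E$. A cover $\mathcal C$ of $\mathcal E$ is minimal if each cover $\mathcal D\subseteq\mathcal C$ of $\mathcal E$ coincides with $\mathcal C$. *)

theory Defs
  imports "HOL-Library.Countable_Set"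
begin

text \<open>A hypergraph is any set of sets; its vertices are the elements of the union of its edges,
  so there is no separate vertex set and isolated vertices do not occur.\<close>

type_synonym 'a hypergraph = "'a set set"

definition countable_hypergraph :: "'a hypergraph \<Rightarrow> bool" where
  "countable_hypergraph \<E> \<longleftrightarrow> countable \<E> \<and> countable (\<Union>\<E>)"

definition is_cover :: "'a hypergraph \<Rightarrow> 'a set set \<Rightarrow> bool" where
  "is_cover \<E> \<C> \<longleftrightarrow> \<C> \<subseteq> \<E> \<and> \<Union>\<C> = \<Union>\<E>"

definition is_minimal_cover :: "'a hypergraph \<Rightarrow> 'a set set \<Rightarrow> bool" where
  "is_minimal_cover \<E> \<C> \<longleftrightarrow>
     is_cover \<E> \<C> \<and> (\<forall>\<D>. is_cover \<E> \<D> \<and> \<D> \<subseteq> \<C> \<longrightarrow> \<D> = \<C>)"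

definition edges_containing :: "'a hypergraph \<Rightarrow> 'a set \<Rightarrow> 'a set set" where
  "edges_containing \<E> F = {E \<in> \<E>. F \<subseteq> E}"

end

theory Submission
  imports Defs
begin

text \<open>
  A cover is minimal as soon as each of its edges has a private vertex, that is, a vertex that lies
  in no other edge of the cover. The proof constructs such covers for arbitrary sets \<open>X\<close> of
  vertices and arbitrary subfamilies, since both have to vary in the construction.

  The key step (\<open>irredundant_cover_from_stars\<close>) glues local covers. Enumerate the vertices as
  \<open>w\<^sub>0, w\<^sub>1, \<dots>\<close> and process the star of each \<open>w\<^sub>n\<close> in turn. At stage \<open>n\<close>, the edges of the current
  star are about to be discarded, so choose from them an irredundant cover of exactly those uncovered
  vertices which no surviving edge can cover. The private vertices found there stay private: earlier
  chosen edges miss them because they were uncovered, later ones because only surviving edges are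
  chosen later. The vertex \<open>w\<^sub>n\<close> itself is covered by the end of stage \<open>n\<close>, as all edges through it
  are then gone. Hence a family has irredundant covers as soon as all its stars have them.

  Iterating, if the edges containing a finite set \<open>F\<close> fail to have irredundant covers, then so do
  the edges containing \<open>insert v F\<close> for some new vertex \<open>v\<close>. Starting from the empty set, a failure
  would thus give an infinite strictly increasing sequence of finite sets \<open>F\<close>, each contained in
  infinitely many edges, because finite families cause no failure. The union of the sequence is an
  infinite set that violates the hypothesis.
\<close>

section \<open>Covers whose edges have private vertices\<close>

definition irredundant_cover :: "'a set \<Rightarrow> 'a set set \<Rightarrow> bool" where
  "irredundant_cover X \<C> \<longleftrightarrow>
     X \<subseteq> \<Union>\<C> \<and> (\<forall>E\<in>\<C>. \<exists>x\<in>X \<inter> E. \<forall>E'\<in>\<C>. x \<in> E' \<longrightarrow> E' = E)"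

lemma irredundant_cover_imp_minimal_cover:
  assumes "\<C> \<subseteq> \<E>" and "irredundant_cover (\<Union>\<E>) \<C>"
  shows "is_minimal_cover \<E> \<C>"
proof -
  have "is_cover \<E> \<C>"
    using assms unfolding is_cover_def irredundant_cover_def by blast
  moreover have "\<D> = \<C>" if "is_cover \<E> \<D>" "\<D> \<subseteq> \<C>" for \<D>
  proof -
    have "E \<in> \<D>" if "E \<in> \<C>" for E
    proof -
      have "\<exists>x\<in>\<Union>\<E> \<inter> E. \<forall>E'\<in>\<C>. x \<in> E' \<longrightarrow> E' = E"
        using assms(2) \<open>E \<in> \<C>\<close> by (simp add: irredundant_cover_def)
      then obtain x where "x \<in> \<Union>\<E>" and only: "\<forall>E'\<in>\<C>. x \<in> E' \<longrightarrow> E' = E"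
        by (elim bexE IntE)
      moreover have "\<Union>\<D> = \<Union>\<E>"
        using \<open>is_cover \<E> \<D>\<close> by (simp add: is_cover_def)
      ultimately obtain E' where "E' \<in> \<D>" "x \<in> E'"
        by (metis UnionE)
      then have "E' = E"
        using only \<open>\<D> \<subseteq> \<C>\<close> by (simp add: subset_iff)
      then show ?thesis
        using \<open>E' \<in> \<D>\<close> by simp
    qed
    then show ?thesis
      using \<open>\<D> \<subseteq> \<C>\<close> by blast
  qed
  ultimately show ?thesis
    by (simp add: is_minimal_cover_def)
qed

lemma irredundant_cover_superset:
  assumes "irredundant_cover Y \<C>" and "Y \<subseteq> X" and "X \<subseteq> \<Union>\<C>"
  shows "irredundant_cover X \<C>"
  unfolding irredundant_cover_def
proof (intro conjI ballI)
  fix E assume "E \<in> \<C>"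
  then have "\<exists>x\<in>Y \<inter> E. \<forall>E'\<in>\<C>. x \<in> E' \<longrightarrow> E' = E"
    using assms(1) by (simp add: irredundant_cover_def)
  moreover have "Y \<inter> E \<subseteq> X \<inter> E"
    using assms(2) by blast
  ultimately show "\<exists>x\<in>X \<inter> E. \<forall>E'\<in>\<C>. x \<in> E' \<longrightarrow> E' = E"
    by (meson subsetD)
qed (rule assms(3))

lemma irredundant_cover_of_finite:
  assumes "finite \<G>" and "X \<subseteq> \<Union>\<G>"
  shows "\<exists>\<C>\<subseteq>\<G>. irredundant_cover X \<C>"
proof -
  let ?covers = "{\<C>. \<C> \<subseteq> \<G> \<and> X \<subseteq> \<Union>\<C>}"
  have "finite ?covers" "?covers \<noteq> {}"
    using assms by auto
  then obtain \<C> where \<C>: "\<C> \<subseteq> \<G>" "X \<subseteq> \<Union>\<C>"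
    and least: "\<And>\<D>. \<D> \<in> ?covers \<Longrightarrow> \<D> \<subseteq> \<C> \<Longrightarrow> \<C> = \<D>"
    using finite_has_minimal[of ?covers] by auto
  have "\<exists>x\<in>X \<inter> E. \<forall>E'\<in>\<C>. x \<in> E' \<longrightarrow> E' = E" if "E \<in> \<C>" for E
  proof -
    have "\<not> X \<subseteq> \<Union>(\<C> - {E})"
      using least[of "\<C> - {E}"] \<C> that by blast
    then obtain x where x: "x \<in> X" and only: "\<And>E'. E' \<in> \<C> \<Longrightarrow> x \<in> E' \<Longrightarrow> E' = E"
      by blast
    then have "x \<in> E"
      using \<C>(2) by auto
    then show ?thesis
      using x only by (intro bexI[of _ x]) simp_all
  qed
  then show ?thesis
    using \<C> unfolding irredundant_cover_def by blast
qed

section \<open>Gluing covers of stars\<close>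

text \<open>
  Below, \<open>R n\<close> is the family of edges that survive the first \<open>n\<close> stages, \<open>S n\<close> the star that is
  discarded at stage \<open>n\<close>, \<open>U n\<close> the set of vertices covered so far, and \<open>Z n u\<close> the set of vertices
  which, if \<open>u\<close> is already covered, only the star \<open>S n\<close> can still cover.
\<close>

lemma irredundant_cover_from_stars:
  assumes "countable X" and "X \<subseteq> \<Union>\<G>"
    and star: "\<And>v \<H> Y. v \<in> X \<Longrightarrow> \<H> \<subseteq> \<G> \<Longrightarrow> \<forall>E\<in>\<H>. v \<in> E \<Longrightarrow> Y \<subseteq> X \<Longrightarrow> Y \<subseteq> \<Union>\<H>
                 \<Longrightarrow> \<exists>\<C>\<subseteq>\<H>. irredundant_cover Y \<C>"
  shows "\<exists>\<C>\<subseteq>\<G>. irredundant_cover X \<C>"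
proof (cases "X = {}")
  case True
  then show ?thesis
    by (intro exI[of _ "{}"]) (simp add: irredundant_cover_def)
next
  case False
  define w where "w = from_nat_into X"
  have range_w: "range w = X"
    using False \<open>countable X\<close> by (simp add: w_def)
  define R where "R n = {E \<in> \<G>. \<forall>i<n. w i \<notin> E}" for n :: nat
  define S where "S n = {E \<in> R n. w n \<in> E}" for n
  define Z where "Z n u = X - u - \<Union>(R (Suc n))" for n u
  define choice where
    "choice n u = (SOME \<C>. \<C> \<subseteq> S n \<and> irredundant_cover (Z n u) \<C>)" for n u
  define U where "U = rec_nat {} (\<lambda>n u. u \<union> \<Union>(choice n u))"
  have U_0: "U 0 = {}" and U_Suc: "\<And>n. U (Suc n) = U n \<union> \<Union>(choice n (U n))"
    by (simp_all add: U_def)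
  have R_Suc: "R (Suc n) = R n - S n" for n
    by (auto simp: R_def S_def less_Suc_eq)
  have R_antimono: "R n \<subseteq> R m" if "m \<le> n" for m n
    using that by (auto simp: R_def)
  have U_mono: "U m \<subseteq> U n" if "m \<le> n" for m n
    by (rule lift_Suc_mono_le[OF _ that]) (simp add: U_Suc)

  have choice: "choice n u \<subseteq> S n \<and> irredundant_cover (Z n u) (choice n u)"
    if "X - u \<subseteq> \<Union>(R n)" for n u
  proof -
    have "\<exists>\<C>\<subseteq>S n. irredundant_cover (Z n u) \<C>"
    proof (rule star[of "w n"])
      show "w n \<in> X" using range_w by blast
      show "S n \<subseteq> \<G>" "\<forall>E\<in>S n. w n \<in> E" by (auto simp: S_def R_def)
      show "Z n u \<subseteq> X" by (auto simp: Z_def)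
      show "Z n u \<subseteq> \<Union>(S n)" using that R_Suc[of n] unfolding Z_def by blast
    qed
    then show ?thesis
      unfolding choice_def by (rule someI_ex)
  qed
  \<comment> \<open>The surviving edges can always complete the cover, so that no stage gets stuck.\<close>
  have uncovered: "X - U n \<subseteq> \<Union>(R n)" for n
  proof (induction n)
    case 0
    show ?case using \<open>X \<subseteq> \<Union>\<G>\<close> by (auto simp: U_0 R_def)
  next
    case (Suc n)
    have "Z n (U n) \<subseteq> \<Union>(choice n (U n))"
      using choice[OF Suc.IH] by (simp add: irredundant_cover_def)
    then show ?case
      by (auto simp: Z_def U_Suc)
  qed

  define \<C> where "\<C> n = choice n (U n)" for n
  have \<C>_sub: "\<C> n \<subseteq> S n" and \<C>_irr: "irredundant_cover (Z n (U n)) (\<C> n)" for n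
    using choice[OF uncovered] by (auto simp: \<C>_def)
  have \<C>_U: "\<Union>(\<C> m) \<subseteq> U n" if "m < n" for m n
    using U_mono[of "Suc m" n] that by (auto simp: U_Suc \<C>_def)
  have \<C>_R: "\<C> m \<subseteq> R (Suc n)" if "n < m" for m n
    using \<C>_sub[of m] R_antimono[of "Suc n" m] that by (auto simp: S_def)

  have U_covered: "U n \<subseteq> \<Union>(\<Union>i. \<C> i)" for n
    by (induction n) (auto simp: U_0 U_Suc \<C>_def)
  have "w n \<in> \<Union>(\<Union>i. \<C> i)" for n
  proof -
    have "w n \<notin> \<Union>(R (Suc n))"
      by (auto simp: R_def)
    then have "w n \<in> U (Suc n)"
      using uncovered[of "Suc n"] range_w by blast
    then show ?thesis
      using U_covered by blast
  qed
  then have "X \<subseteq> \<Union>(\<Union>i. \<C> i)"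
    using range_w by blast
  moreover have "\<exists>x\<in>X \<inter> E. \<forall>E'\<in>(\<Union>i. \<C> i). x \<in> E' \<longrightarrow> E' = E" if "E \<in> \<C> n" for E n
  proof -
    obtain x where x: "x \<in> Z n (U n)" "x \<in> E" and only: "\<forall>E'\<in>\<C> n. x \<in> E' \<longrightarrow> E' = E"
      using \<C>_irr[of n] \<open>E \<in> \<C> n\<close> unfolding irredundant_cover_def by blast
    have "E' = E" if "E' \<in> \<C> m" "x \<in> E'" for E' m
    proof (cases m n rule: linorder_cases)
      case less
      then show ?thesis using \<C>_U[OF less] x that by (auto simp: Z_def)
    next
      case equal
      then show ?thesis using only that by blast
    next
      case greater
      then show ?thesis using \<C>_R[OF greater] x that by (auto simp: Z_def)
    qed
    then show ?thesis
      using x by (auto simp: Z_def)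
  qed
  ultimately have "irredundant_cover X (\<Union>i. \<C> i)"
    unfolding irredundant_cover_def by blast
  moreover have "(\<Union>i. \<C> i) \<subseteq> \<G>"
    using \<C>_sub by (auto simp: S_def R_def)
  ultimately show ?thesis
    by blast
qed

section \<open>Descent along finite sets of vertices\<close>

text \<open>
  The property quantifies over subfamilies because the gluing construction uses only part of each
  star, and over \<open>X\<close> because it asks for covers of only some of the vertices.
\<close>

definition covers_above :: "'a hypergraph \<Rightarrow> 'a set \<Rightarrow> bool" where
  "covers_above \<E> F \<longleftrightarrow>
     (\<forall>\<G> X. \<G> \<subseteq> edges_containing \<E> F \<longrightarrow> X \<subseteq> \<Union>\<G> \<longrightarrow> (\<exists>\<C>\<subseteq>\<G>. irredundant_cover X \<C>))"

lemma covers_aboveD: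
  assumes "covers_above \<E> F" "\<G> \<subseteq> edges_containing \<E> F" "X \<subseteq> \<Union>\<G>"
  shows "\<exists>\<C>\<subseteq>\<G>. irredundant_cover X \<C>"
  using assms by (simp add: covers_above_def)

lemma covers_above_if_finite:
  assumes "finite (edges_containing \<E> F)"
  shows "covers_above \<E> F"
  unfolding covers_above_def
  by (intro allI impI irredundant_cover_of_finite) (rule finite_subset[OF _ assms])

text \<open>
  The star of a vertex of \<open>F\<close> is the whole family and so carries no information. Therefore only the
  vertices outside \<open>F\<close> are covered by gluing; any edge used for them contains \<open>F\<close> anyway.
\<close>

lemma covers_above_step:
  assumes "countable (\<Union>\<E>)"
    and above: "\<And>v. v \<in> \<Union>\<E> - F \<Longrightarrow> covers_above \<E> (insert v F)"
  shows "covers_above \<E> F"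
  unfolding covers_above_def
proof (intro allI impI)
  fix \<G> X
  assume \<G>: "\<G> \<subseteq> edges_containing \<E> F" and X: "X \<subseteq> \<Union>\<G>"
  have F_sub: "F \<subseteq> E" if "E \<in> \<G>" for E
    using \<G> that by (auto simp: edges_containing_def)
  have "\<G> \<subseteq> \<E>"
    using \<G> by (auto simp: edges_containing_def)
  then have X_vertices: "X \<subseteq> \<Union>\<E>"
    using X by blast
  show "\<exists>\<C>\<subseteq>\<G>. irredundant_cover X \<C>"
  proof (cases "X \<subseteq> F")
    case True
    show ?thesis
    proof (cases "X = {}")
      case True
      then show ?thesis
        by (intro exI[of _ "{}"]) (simp add: irredundant_cover_def)
    next
      case False
      then obtain E where "E \<in> \<G>"
        using X by blast
      then have "X \<subseteq> E"
        using F_sub \<open>X \<subseteq> F\<close> by blast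
      then have "irredundant_cover X {E}"
        using False by (simp add: irredundant_cover_def Int_absorb2 ex_in_conv)
      then show ?thesis
        using \<open>E \<in> \<G>\<close> by blast
    qed
  next
    case False
    have "\<exists>\<C>\<subseteq>\<G>. irredundant_cover (X - F) \<C>"
    proof (rule irredundant_cover_from_stars)
      show "countable (X - F)"
        using X_vertices \<open>countable (\<Union>\<E>)\<close> countable_subset by blast
      show "X - F \<subseteq> \<Union>\<G>"
        using X by blast
      fix v \<H> Y
      assume "v \<in> X - F" "\<H> \<subseteq> \<G>" "\<forall>E\<in>\<H>. v \<in> E" "Y \<subseteq> \<Union>\<H>"
      then have "\<H> \<subseteq> edges_containing \<E> (insert v F)"
        using \<G> by (auto simp: edges_containing_def)
      moreover have "covers_above \<E> (insert v F)"
        using \<open>v \<in> X - F\<close> X_vertices by (intro above) blast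
      ultimately show "\<exists>\<C>\<subseteq>\<H>. irredundant_cover Y \<C>"
        using \<open>Y \<subseteq> \<Union>\<H>\<close> by (intro covers_aboveD)
    qed
    then obtain \<C> where \<C>: "\<C> \<subseteq> \<G>" "irredundant_cover (X - F) \<C>"
      by blast
    moreover have "\<C> \<noteq> {}"
      using \<C> False by (auto simp: irredundant_cover_def)
    ultimately have "F \<subseteq> \<Union>\<C>"
      using F_sub by blast
    moreover have "X - F \<subseteq> \<Union>\<C>"
      using \<C>(2) by (simp add: irredundant_cover_def)
    ultimately have "X \<subseteq> \<Union>\<C>"
      by blast
    then have "irredundant_cover X \<C>"
      by (rule irredundant_cover_superset[OF \<C>(2) Diff_subset])
    then show ?thesis
      using \<C>(1) by blast
  qed
qed

theorem corollary3p1: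
  fixes \<E> :: "'a hypergraph"
  assumes "countable_hypergraph \<E>"
    and "\<And>I. I \<subseteq> \<Union>\<E> \<Longrightarrow> infinite I \<Longrightarrow>
           \<exists>F. F \<subseteq> I \<and> finite F \<and> finite (edges_containing \<E> F)"
  shows "\<exists>\<C>. is_minimal_cover \<E> \<C>"
proof -
  have countable: "countable (\<Union>\<E>)"
    using assms(1) by (simp add: countable_hypergraph_def)
  have "covers_above \<E> {}"
  proof (rule ccontr)
    assume fails: "\<not> covers_above \<E> {}"
    let ?bad = "\<lambda>F. F \<subseteq> \<Union>\<E> \<and> \<not> covers_above \<E> F"
    have "\<exists>A. \<forall>n. ?bad (A n) \<and> A n \<subset> A (Suc n)"
    proof (rule dependent_nat_choice)
      show "\<exists>F. ?bad F"
        using fails by blast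
    next
      fix F and n :: nat
      assume "?bad F"
      then obtain v where "v \<in> \<Union>\<E> - F" "\<not> covers_above \<E> (insert v F)"
        using covers_above_step[OF countable] by blast
      then show "\<exists>F'. ?bad F' \<and> F \<subset> F'"
        using \<open>?bad F\<close> by (intro exI[of _ "insert v F"]) blast
    qed
    then obtain A where A: "\<forall>n. ?bad (A n) \<and> A n \<subset> A (Suc n)"
      by (rule exE)
    then have bad: "\<And>n. ?bad (A n)" and A_Suc: "\<And>n. A n \<subset> A (Suc n)"
      by simp_all
    have "strict_mono A"
      using A_Suc by (simp add: strict_mono_Suc_iff)
    then have "inj A" and mono: "\<And>m n. m \<le> n \<Longrightarrow> A m \<subseteq> A n"
      by (simp_all add: strict_mono_imp_inj_on strict_mono_less_eq)
    have "infinite (\<Union>n. A n)"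
    proof
      assume "finite (\<Union>n. A n)"
      then have "finite (Pow (\<Union>n. A n))"
        by simp
      moreover have "range A \<subseteq> Pow (\<Union>n. A n)"
        by auto
      ultimately have "finite (range A)"
        by (rule rev_finite_subset)
      then show False
        using range_inj_infinite[OF \<open>inj A\<close>] by simp
    qed
    moreover have "(\<Union>n. A n) \<subseteq> \<Union>\<E>"
      using bad by (intro UN_least) simp
    ultimately obtain F where F: "F \<subseteq> (\<Union>n. A n)" "finite F" "finite (edges_containing \<E> F)"
      using assms(2)[of "\<Union>n. A n"] by blast
    have "\<exists>n. F \<subseteq> A n"
      using F(2,1)
    proof (induction rule: finite_induct)
      case (insert x F)
      then obtain m n where "x \<in> A m" "F \<subseteq> A n"
        by blast
      then have "insert x F \<subseteq> A (max m n)"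
        using mono[of m "max m n"] mono[of n "max m n"] by auto
      then show ?case
        by blast
    qed simp
    then obtain n where "F \<subseteq> A n"
      by blast
    then have "edges_containing \<E> (A n) \<subseteq> edges_containing \<E> F"
      by (auto simp: edges_containing_def)
    then show False
      using covers_above_if_finite[OF finite_subset] F(3) bad[of n] by metis
  qed
  then obtain \<C> where "\<C> \<subseteq> \<E>" "irredundant_cover (\<Union>\<E>) \<C>"
    using covers_aboveD[of \<E> "{}" \<E> "\<Union>\<E>"] by (auto simp: edges_containing_def)
  then show ?thesis
    using irredundant_cover_imp_minimal_cover by blast
qed

end
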